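(* Let $L>0$, let $n\ge 1$ be an integer, let $r\in(0,1)$, and set $h=L/n$, where it is assumed that $h<1-r$. Assume $r\le 1/2$ and $h\le 1/4$. Let $G$, $x_k$, $D_k$, $D_k^{(r)}$ be the stadium, points and disks defined in the context. For $\varepsilon\in(0,1)$ define $$\varepsilon_k=\varepsilon^{\exp(-\tilde e\,x_k)}\quad(0\le k\le n),\qquad \tilde e=\frac{1+2h}{r\log(1/r)}.$$ Then for all sufficiently small $\varepsilon$ (that is, there is $\varepsilon^*\in(0,1)$ depending only on $L,n,r$ such that for all $\varepsilon\in(0,\varepsilon^* )$) the following holds. Let $f$ be analytic in $G$ with $\|f\|_G\le 1$, and for $0\le k\le n-1$ let $f_k$ be analytic in $D_k$ with $\|f_k\|_{D_k}\le 1$. If $$\|f_0-f\|_{D_0^{(r)}}\le\varepsilon_0$$ and $$\|f_k-f_{k-1}\|_{D_k^{(r)}}\le\varepsilon_k,\qquad 1\le k\le n-1,$$ then $$\|f_{k-1}-f\|_{D_k^{(r)}}\le\varepsilon_k,\qquad 1\le k\le n.$$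
   Context: For a set $A\subset\mathbb{C}$, $\|\cdot\|_A$ denotes the supremum norm over $A$. The stadium $G$ is the strip of half-width $1$ about the real axis extending from $x=0$ to $x=L$ together with half-disks of radius $1$ at each end, i.e. the open set of points of $\mathbb{C}$ at distance less than $1$ from the real segment $[0,L]$. For $0\le k\le n$, $x_k=kh$, $D_k=\{z\in\mathbb{C}: |z-x_k|<1\}$ and $D_k^{(r)}=\{z\in\mathbb{C}: |z-x_k|<r\}$. (Since $h<1-r$, one has $D_k^{(r)}\subset D_{k-1}$, so the norms in the claim make sense.) *)

theory Defs
  imports "HOL-Analysis.Analysis"
begin

(* Valued in ennreal, so that the norm of an unbounded function is infinite;
   a real-valued supremum would be unspecified there. *)
definition sup_norm :: "complex set \<Rightarrow> (complex \<Rightarrow> complex) \<Rightarrow> ennreal" where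
  "sup_norm A f = (SUP z\<in>A. ennreal (norm (f z)))"

definition stadium :: "real \<Rightarrow> complex set" where
  "stadium L = {z. infdist z (closed_segment 0 (complex_of_real L)) < 1}"

definition node :: "real \<Rightarrow> nat \<Rightarrow> real" where
  "node h k = real k * h"

definition disk :: "real \<Rightarrow> nat \<Rightarrow> real \<Rightarrow> complex set" where
  "disk h k r = ball (complex_of_real (node h k)) r"

definition rate :: "real \<Rightarrow> real \<Rightarrow> real" where
  "rate h r = (1 + 2 * h) / (r * ln (1 / r))"

definition eps_at :: "real \<Rightarrow> real \<Rightarrow> real \<Rightarrow> nat \<Rightarrow> real" where
  "eps_at h r \<epsilon> k = \<epsilon> powr exp (- rate h r * node h k)"

end

theory Submission
  imports Defs "HOL-Complex_Analysis.Complex_Analysis"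
begin

text \<open>
  If $g$ is bounded by $2$ on a unit disk and by $\delta$ on the concentric disk of radius $r$,
  the three circles theorem bounds it on radius $r + h$ by a constant times $\delta^\alpha$ with
  $\alpha = \ln(r+h)/\ln r$.  The exponent lost in passing from $\varepsilon_k$ to
  $\varepsilon_{k+1}$ is $\exp(-\tilde e h)$, which is strictly smaller than $\alpha$; for small
  $\varepsilon$ this gap absorbs all constants.  In particular a lossy version of the three circles
  theorem suffices: dividing $g$ by an integer power $z^p$, with $p$ the integer part of
  $\ln\delta/\ln r$, costs only a factor $1/(r+h)$.

  The strict inequality $\exp(-\tilde e h) < \alpha$ becomes, after taking logarithms and
  differentiating in $h$, the claim that $(1+4h)\varphi(r+h) > \varphi(r)$ for the concave function
  $\varphi(x) = -x\ln x$; it suffices to compare $\varphi$ at $r$ and $r + 1/4$.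
\<close>

section \<open>Sup norms and the stadium\<close>

lemma sup_norm_le_iff:
  assumes "0 \<le> c"
  shows "sup_norm A f \<le> ennreal c \<longleftrightarrow> (\<forall>z\<in>A. norm (f z) \<le> c)"
  using assms by (simp add: sup_norm_def SUP_le_iff)

lemma disk_subset_stadium:
  assumes "0 \<le> node h k" "node h k \<le> L"
  shows "disk h k 1 \<subseteq> stadium L"
proof
  fix z assume z: "z \<in> disk h k 1"
  have "complex_of_real (node h k) \<in> closed_segment 0 (complex_of_real L)"
    using assms closed_segment_of_real[of 0 L] by (auto simp: closed_segment_eq_real_ivl)
  then have "infdist z (closed_segment 0 (complex_of_real L)) \<le> dist z (node h k)"
    by (rule infdist_le)
  with z show "z \<in> stadium L"
    by (simp add: disk_def stadium_def dist_commute)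
qed

section \<open>Three circles with an integer exponent\<close>

text \<open>The maximum principle is applied to \<open>g w / (w - c) ^ p\<close> on the annulus
  between radii \<open>r\<close> and \<open>R\<close>: on both boundary circles the quotient is at
  most \<open>M / R ^ p\<close>, and \<open>R\<close> then tends to 1. An integer \<open>p\<close>
  keeps the quotient single-valued.\<close>

lemma holomorphic_norm_le_power:
  fixes g :: "complex \<Rightarrow> complex" and p :: nat
  assumes hol: "g holomorphic_on ball c 1"
    and bound: "\<And>z. z \<in> ball c 1 \<Longrightarrow> norm (g z) \<le> M"
    and inner: "\<And>z. z \<in> ball c r \<Longrightarrow> norm (g z) \<le> M * r ^ p"
    and "0 < r" "r < s" "s < 1" "z \<in> ball c s"
  shows "norm (g z) \<le> M * s ^ p"
proof -
  have M: "0 \<le> M"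
    using bound[of c] by (smt (verit) centre_in_ball norm_ge_zero)
  have cont: "continuous_on (ball c 1) g"
    using hol by (rule holomorphic_on_imp_continuous_on)
  \<comment> \<open>The bound has to reach the circle of radius \<open>r\<close>, which belongs to
    the frontier of the annulus.\<close>
  have inner': "norm (g w) \<le> M * r ^ p" if "w \<in> cball c r" for w
  proof (rule continuous_on_closure_norm_le[where s = "ball c r" and f = g and x = w])
    show "continuous_on (closure (ball c r)) g"
      using assms by (intro continuous_on_subset[OF cont]) auto
  qed (use assms that in auto)
  \<comment> \<open>\<open>R\<close> stays below 1 because \<open>g\<close> is controlled only on
    the open disk, which must contain the outer circle.\<close>
  have on_annulus: "norm (g z) \<le> M * (dist c z / R) ^ p" if R: "s < R" "R < 1" and z: "r < dist c z" for R
  proof -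
    define A where "A = ball c R - cball c r"
    have clos: "closure A \<subseteq> cball c R - ball c r"
      unfolding A_def by (intro closure_minimal closed_Diff) auto
    have nz: "w \<noteq> c" if "w \<in> closure A" for w
      using clos that \<open>0 < r\<close> by auto
    have sub: "closure A \<subseteq> ball c 1"
      using clos R by auto
    have "open A"
      unfolding A_def by (intro open_Diff) auto
    have "norm (g z / (z - c) ^ p) \<le> M / R ^ p"
    proof (rule maximum_modulus_frontier[where f = "\<lambda>w. g w / (w - c) ^ p" and S = A])
      show "(\<lambda>w. g w / (w - c) ^ p) holomorphic_on interior A"
        using nz sub closure_subset interior_subset
        by (intro holomorphic_intros holomorphic_on_subset[OF hol]) (simp | blast)+
      show "continuous_on (closure A) (\<lambda>w. g w / (w - c) ^ p)"
        using nz sub by (intro continuous_intros continuous_on_subset[OF cont]) auto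
      show "bounded A"
        unfolding A_def by (rule bounded_subset[of "ball c R"]) auto
      show "z \<in> A"
        using assms R z by (auto simp: A_def)
    next
      fix w assume w: "w \<in> frontier A"
      then have "w \<in> closure A" "w \<notin> A"
        using \<open>open A\<close> by (auto simp: frontier_def interior_open)
      with clos consider "dist c w = r" | "dist c w = R"
        by (force simp: A_def)
      then show "norm (g w / (w - c) ^ p) \<le> M / R ^ p"
      proof cases
        case 1
        then have "norm (g w / (w - c) ^ p) \<le> M * r ^ p / r ^ p"
          using inner'[of w] \<open>0 < r\<close>
          by (simp add: norm_divide norm_power dist_norm norm_minus_commute pos_divide_le_eq)
        also have "\<dots> = M / 1"
          using \<open>0 < r\<close> by simp
        also have "\<dots> \<le> M / R ^ p"
          using M R assms by (intro divide_left_mono) (auto simp: power_le_one)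
        finally show ?thesis .
      next
        case 2
        then show ?thesis
          using bound[of w] R assms
          by (simp add: norm_divide norm_power dist_norm norm_minus_commute divide_right_mono)
      qed
    qed
    moreover have "0 < dist c z"
      using z \<open>0 < r\<close> by linarith
    ultimately show ?thesis
      using R by (simp add: norm_divide norm_power dist_norm norm_minus_commute field_simps)
  qed
  show ?thesis
  proof (cases "r < dist c z")
    case True
    have "norm (g z) \<le> M * (dist c z / 1) ^ p"
    proof (rule tendsto_lowerbound)
      show "((\<lambda>R. M * (dist c z / R) ^ p) \<longlongrightarrow> M * (dist c z / 1) ^ p) (at_left (1::real))"
        by (intro tendsto_intros) auto
      show "\<forall>\<^sub>F R in at_left (1::real). norm (g z) \<le> M * (dist c z / R) ^ p"
        using eventually_at_left_real[OF \<open>s < 1\<close>] by eventually_elim (use on_annulus True in auto)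
    qed simp
    also have "\<dots> \<le> M * s ^ p"
      using M \<open>z \<in> ball c s\<close> by (intro mult_left_mono power_mono) auto
    finally show ?thesis .
  next
    case False
    then have "norm (g z) \<le> M * r ^ p"
      by (intro inner') auto
    also have "\<dots> \<le> M * s ^ p"
      using assms M by (intro mult_left_mono power_mono) auto
    finally show ?thesis .
  qed
qed

text \<open>For \<open>m = ln \<delta> / ln r\<close> one has \<open>\<delta> = r powr m\<close> and
  \<open>s powr m = \<delta> powr (ln s / ln r)\<close>. Rounding \<open>m\<close> down to an
  integer only weakens the inner bound, and costs at most one factor \<open>1 / s\<close> in the
  conclusion.\<close>

lemma three_circles_lossy:
  fixes g :: "complex \<Rightarrow> complex"
  assumes hol: "g holomorphic_on ball c 1"
    and bound: "\<And>z. z \<in> ball c 1 \<Longrightarrow> norm (g z) \<le> M"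
    and inner: "\<And>z. z \<in> ball c r \<Longrightarrow> norm (g z) \<le> M * \<delta>"
    and "0 < r" "r < s" "s < 1" "0 < \<delta>" "\<delta> < 1" "z \<in> ball c s"
  shows "norm (g z) \<le> M / s * \<delta> powr (ln s / ln r)"
proof -
  define m where "m = ln \<delta> / ln r"
  define p where "p = nat \<lfloor>m\<rfloor>"
  have M: "0 \<le> M"
    using bound[of c] by (smt (verit) centre_in_ball norm_ge_zero)
  have ln_neg: "ln r < 0" "ln s < 0" "ln \<delta> < 0"
    using assms by auto
  \<comment> \<open>Positivity keeps \<open>nat\<close> from truncating, so that \<open>p\<close>
    does not exceed \<open>m\<close>.\<close>
  have "0 < m"
    using ln_neg by (simp add: m_def divide_neg_neg)
  then have p: "real p \<le> m" "m - 1 \<le> real p"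
    unfolding p_def by linarith+
  have "\<delta> = r powr m"
    using assms ln_neg by (simp add: m_def powr_def)
  also have "\<dots> \<le> r powr real p"
    using p assms by (intro powr_mono') auto
  also have "\<dots> = r ^ p"
    using assms by (simp add: powr_realpow)
  finally have "M * \<delta> \<le> M * r ^ p"
    using M by (rule mult_left_mono)
  then have "norm (g w) \<le> M * r ^ p" if "w \<in> ball c r" for w
    using inner[OF that] by linarith
  from holomorphic_norm_le_power[OF hol bound this \<open>0 < r\<close> \<open>r < s\<close> \<open>s < 1\<close> \<open>z \<in> ball c s\<close>]
  have "norm (g z) \<le> M * s ^ p" .
  also have "s ^ p = s powr real p"
    using assms by (simp add: powr_realpow)
  also have "\<dots> \<le> s powr (m - 1)"
    using p assms by (intro powr_mono') auto
  also have "\<dots> = s powr m / s"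
    using assms by (simp add: powr_diff)
  also have "s powr m = \<delta> powr (ln s / ln r)"
    using assms by (simp add: m_def powr_def)
  finally show ?thesis
    using M by (simp add: mult_left_mono)
qed

section \<open>Comparison of the two exponents\<close>

lemma concave_on_neg_xlnx: "concave_on {0<..} (\<lambda>x::real. - (x * ln x))"
  by (rule f''_le0_imp_concave[where f' = "\<lambda>x. - ln x - 1" and f'' = "\<lambda>x. - 1 / x"])
     (auto intro!: derivative_eq_intros simp: field_simps)

text \<open>The true maximum is 1/e, and e > 8/3. The constant 3/8 is twice the lower bound 3/16
  that \<open>neg_xlnx_growth\<close> finds at \<open>r + 1 / 4\<close>.\<close>

lemma neg_xlnx_less:
  assumes "0 < (x::real)"
  shows "- (x * ln x) < 3 / 8"
proof -
  have "(8 / 3 :: real) < exp 1"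
    using e_approx_32 by (simp add: abs_if field_simps split: if_splits)
  then have "ln (8 / 3) < (1::real)"
    by (metis exp_gt_zero ln_exp ln_less_cancel_iff zero_less_divide_iff zero_less_numeral)
  moreover have "ln (3 / (8 * x)) \<le> 3 / (8 * x) - 1"
    using assms by (intro ln_le_minus_one) auto
  moreover have "ln (3 / (8 * x)) = - ln (8 / 3) - ln x"
    using assms by (simp add: ln_div ln_mult)
  ultimately have "- ln x < 3 / (8 * x)"
    by linarith
  then show ?thesis
    using assms by (simp add: field_simps)
qed

text \<open>The function \<open>\<phi>\<close> lies above its chord from \<open>r\<close> to
  \<open>r + 1 / 4\<close>. Since \<open>\<phi> (r + 1 / 4)\<close> exceeds half of
  \<open>\<phi> r\<close>, the chord at \<open>r + t\<close> exceeds
  \<open>(1 - u / 2) * \<phi> r\<close> with \<open>u = 4 * t\<close>, and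
  \<open>(1 + u) * (1 - u / 2)\<close> is at least 1 for \<open>u\<close> in [0,1].\<close>

lemma neg_xlnx_growth:
  fixes r t :: real
  assumes "0 < r" "r \<le> 1 / 2" "0 < t" "t \<le> 1 / 4"
  shows "- (r * ln r) < (1 + 4 * t) * - ((r + t) * ln (r + t))"
proof -
  define \<phi> where "\<phi> x = - (x * ln x)" for x :: real
  define u where "u = 4 * t"
  have u: "0 < u" "u \<le> 1"
    using assms by (auto simp: u_def)
  have "(1 - u) * \<phi> r + u * \<phi> (r + 1 / 4) \<le> \<phi> ((1 - u) * r + u * (r + 1 / 4))"
    using concave_onD[OF concave_on_neg_xlnx, of u r "r + 1/4"] u assms by (simp add: \<phi>_def)
  also have "(1 - u) * r + u * (r + 1 / 4) = r + t"
    by (simp add: u_def algebra_simps)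
  finally have conc: "(1 - u) * \<phi> r + u * \<phi> (r + 1 / 4) \<le> \<phi> (r + t)" .
  have "ln (r + 1 / 4) \<le> r + 1 / 4 - 1"
    using assms by (intro ln_le_minus_one) auto
  then have "(r + 1 / 4) * (3 / 4 - r) \<le> \<phi> (r + 1 / 4)"
    unfolding \<phi>_def minus_mult_right using assms by (intro mult_left_mono) auto
  \<comment> \<open>The product equals \<open>3 / 16 + r * (1 / 2 - r)\<close>.\<close>
  moreover have "3 / 16 \<le> (r + 1 / 4) * (3 / 4 - r)"
  proof -
    have "0 \<le> r * (1 / 2 - r)"
      using assms by simp
    then show ?thesis
      by (simp add: algebra_simps)
  qed
  moreover have "\<phi> r < 3 / 8"
    using neg_xlnx_less[OF \<open>0 < r\<close>] by (simp only: \<phi>_def)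
  ultimately have half: "\<phi> r < 2 * \<phi> (r + 1 / 4)"
    by linarith
  have "0 < \<phi> r"
    using assms by (simp add: \<phi>_def mult_pos_neg)
  have "(1 - u) * \<phi> r + u * (\<phi> r / 2) < (1 - u) * \<phi> r + u * \<phi> (r + 1 / 4)"
    using half u by (intro add_strict_left_mono mult_strict_left_mono) auto
  moreover have "(1 - u) * \<phi> r + u * (\<phi> r / 2) = (1 - u / 2) * \<phi> r"
    by (simp add: algebra_simps)
  ultimately have "(1 - u / 2) * \<phi> r < \<phi> (r + t)"
    using conc by linarith
  then have "(1 + u) * ((1 - u / 2) * \<phi> r) < (1 + u) * \<phi> (r + t)"
    using u by (intro mult_strict_left_mono) auto
  moreover have "\<phi> r \<le> (1 + u) * ((1 - u / 2) * \<phi> r)"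
  proof -
    have "0 \<le> u * (1 - u) * \<phi> r"
      using u \<open>0 < \<phi> r\<close> by simp
    then show ?thesis
      by (simp add: algebra_simps)
  qed
  ultimately show ?thesis
    by (simp add: \<phi>_def u_def)
qed

lemma exp_rate_less:
  fixes r h :: real
  assumes "0 < r" "r \<le> 1 / 2" "0 < h" "h \<le> 1 / 4"
  shows "exp (- rate h r * h) < ln (r + h) / ln r"
proof -
  define l where "l = - ln r"
  have l: "0 < l"
    using assms by (simp add: l_def)
  \<comment> \<open>\<open>F h - F 0\<close> is the logarithm of the quotient of the two sides to be
    compared. The second term is \<open>rate t r * t\<close>: the step size inside the rate varies
    with \<open>t\<close> as well, whence the factor \<open>1 + 4 * t\<close> in the
    derivative.\<close>
  define F where "F t = ln (- ln (r + t)) + (t + 2 * t\<^sup>2) / (r * l)" for t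
  define F' where "F' t = 1 / ((r + t) * ln (r + t)) + (1 + 4 * t) / (r * l)" for t
  have neg: "ln (r + t) < 0" if "0 \<le> t" "t \<le> h" for t
    using that assms by simp
  have deriv: "(F has_real_derivative F' t) (at t)" if "0 \<le> t" "t \<le> h" for t
    unfolding F_def F'_def
    using neg[OF that] that assms l
    by (auto intro!: derivative_eq_intros simp: field_simps)
  have "F 0 < F h"
  proof (rule DERIV_pos_imp_increasing_open[OF \<open>0 < h\<close>])
    fix t assume t: "0 < t" "t < h"
    \<comment> \<open>In terms of \<open>P\<close>, the derivative \<open>F' t\<close> is
      \<open>(1 + 4 * t) / (r * l) - 1 / P\<close>.\<close>
    define P where "P = - ((r + t) * ln (r + t))"
    have "0 < P"
      using neg[of t] t assms by (simp add: P_def mult_pos_neg)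
    moreover have "r * l < (1 + 4 * t) * P"
      using neg_xlnx_growth[of r t] t assms by (simp add: l_def P_def)
    ultimately have "1 / P < (1 + 4 * t) / (r * l)"
      using assms l by (simp add: field_simps)
    then have "0 < F' t"
      by (simp add: F'_def P_def)
    with deriv[of t] t show "\<exists>y. (F has_real_derivative y) (at t) \<and> 0 < y"
      by auto
  next
    show "continuous_on {0..h} F"
      by (intro continuous_at_imp_continuous_on ballI DERIV_isCont[OF deriv]) auto
  qed
  moreover have "(h + 2 * h\<^sup>2) / (r * l) = rate h r * h"
    using assms by (simp add: rate_def l_def ln_div power2_eq_square field_simps)
  ultimately have "ln l - rate h r * h < ln (- ln (r + h))"
    by (simp add: F_def l_def)
  then have "exp (ln l - rate h r * h) < exp (ln (- ln (r + h)))"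
    by simp
  also have "\<dots> = - ln (r + h)"
    using neg[of h] assms by simp
  finally have "exp (ln l - rate h r * h) < - ln (r + h)" .
  then have "l * exp (- rate h r * h) < - ln (r + h)"
    using l by (simp add: exp_diff exp_minus field_simps)
  then show ?thesis
    using l by (simp add: l_def field_simps)
qed

section \<open>Propagation from node to node\<close>

theorem theorem7p1:
  fixes L r h :: real and n :: nat
  assumes "L > 0" and "n \<ge> 1" and "0 < r" and "r < 1"
    and "h = L / real n" and "h < 1 - r"
    and "r \<le> 1 / 2" and "h \<le> 1 / 4"
  shows "\<exists>\<epsilon>s. 0 < \<epsilon>s \<and> \<epsilon>s < 1 \<and>
    (\<forall>\<epsilon>. 0 < \<epsilon> \<and> \<epsilon> < \<epsilon>s \<longrightarrow>
      (\<forall>(f :: complex \<Rightarrow> complex) (fs :: nat \<Rightarrow> complex \<Rightarrow> complex).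
        f analytic_on stadium L \<and> sup_norm (stadium L) f \<le> 1 \<and>
        (\<forall>k. k \<le> n - 1 \<longrightarrow> fs k analytic_on disk h k 1 \<and> sup_norm (disk h k 1) (fs k) \<le> 1) \<and>
        sup_norm (disk h 0 r) (\<lambda>z. fs 0 z - f z) \<le> ennreal (eps_at h r \<epsilon> 0) \<and>
        (\<forall>k. 1 \<le> k \<and> k \<le> n - 1 \<longrightarrow>
          sup_norm (disk h k r) (\<lambda>z. fs k z - fs (k - 1) z) \<le> ennreal (eps_at h r \<epsilon> k)) \<longrightarrow>
        (\<forall>k. 1 \<le> k \<and> k \<le> n \<longrightarrow>
          sup_norm (disk h k r) (\<lambda>z. fs (k - 1) z - f z) \<le> ennreal (eps_at h r \<epsilon> k))))"
proof -
  \<comment> \<open>One step raises the tolerance to the power \<open>a\<close>, while three circles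
    yields the power \<open>\<alpha>\<close>. The exponent \<open>b\<close> belongs to the last node
    and is the smallest, so \<open>\<epsilon> powr b\<close> bounds all tolerances at once. The
    threshold solves \<open>\<epsilon>s powr (b * (\<alpha> - a)) = r / 2\<close>.\<close>
  define a where "a = exp (- rate h r * h)"
  define \<alpha> where "\<alpha> = ln (r + h) / ln r"
  define b where "b = exp (- rate h r * L)"
  define \<epsilon>s where "\<epsilon>s = (r / 2) powr (1 / (b * (\<alpha> - a)))"
  have h: "0 < h" "real n * h = L" "r + h < 1"
    using assms(1,2,5,6) by (simp, simp, linarith)
  have gap: "a < \<alpha>"
    unfolding a_def \<alpha>_def using assms h by (intro exp_rate_less) auto
  have "0 \<le> rate h r"
    unfolding rate_def using assms h by (intro divide_nonneg_nonneg mult_nonneg_nonneg) auto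
  have "0 < b"
    by (simp add: b_def)
  have "0 < \<epsilon>s"
    using assms(3) by (simp add: \<epsilon>s_def)
  have "\<epsilon>s < 1"
    unfolding \<epsilon>s_def using assms gap \<open>0 < b\<close> by (subst powr01_less_one) auto
  have eps_Suc: "eps_at h r \<epsilon> (Suc k) = eps_at h r \<epsilon> k powr a" for \<epsilon> k
  proof -
    have "- rate h r * node h (Suc k) = - rate h r * node h k + - rate h r * h"
      by (simp add: node_def algebra_simps)
    then show ?thesis
      by (simp only: eps_at_def a_def powr_powr exp_add)
  qed
  have absorb: "2 / (r + h) * eps_at h r \<epsilon> k powr \<alpha> \<le> eps_at h r \<epsilon> (Suc k)"
    and eps_less_1: "eps_at h r \<epsilon> k < 1"
    if "0 < \<epsilon>" "\<epsilon> < \<epsilon>s" "k \<le> n" for \<epsilon> k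
  proof -
    have "node h k \<le> L"
      using that h(1) unfolding node_def h(2)[symmetric] by (intro mult_right_mono) auto
    then have "b \<le> exp (- rate h r * node h k)"
      using \<open>0 \<le> rate h r\<close> by (simp add: b_def mult_left_mono)
    then have "eps_at h r \<epsilon> k \<le> \<epsilon> powr b"
      unfolding eps_at_def using that \<open>\<epsilon>s < 1\<close> by (intro powr_mono') auto
    also have "\<dots> < \<epsilon>s powr b"
      using that \<open>0 < b\<close> by (intro powr_less_mono2) auto
    also have "\<dots> = (r / 2) powr (1 / (\<alpha> - a))"
      using \<open>0 < b\<close> by (simp add: \<epsilon>s_def powr_powr)
    finally have less: "eps_at h r \<epsilon> k < (r / 2) powr (1 / (\<alpha> - a))" .
    also have "\<dots> < 1"
      using assms gap by (subst powr01_less_one) auto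
    finally show "eps_at h r \<epsilon> k < 1" .
    \<comment> \<open>The surplus power \<open>\<alpha> - a\<close> is at most
      \<open>(r + h) / 2\<close>, which cancels the three circles constant
      \<open>2 / (r + h)\<close>.\<close>
    have "eps_at h r \<epsilon> k powr (\<alpha> - a) \<le> ((r / 2) powr (1 / (\<alpha> - a))) powr (\<alpha> - a)"
      using less gap by (intro powr_mono2) (auto simp: eps_at_def)
    also have "\<dots> = r / 2"
      using gap assms by (simp add: powr_powr)
    also have "\<dots> \<le> (r + h) / 2"
      using h by simp
    finally have "eps_at h r \<epsilon> k powr (\<alpha> - a) * eps_at h r \<epsilon> k powr a
        \<le> (r + h) / 2 * eps_at h r \<epsilon> k powr a"
      by (rule mult_right_mono) simp
    then have "eps_at h r \<epsilon> k powr \<alpha> \<le> (r + h) / 2 * eps_at h r \<epsilon> (Suc k)"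
      by (simp add: eps_Suc flip: powr_add)
    then show "2 / (r + h) * eps_at h r \<epsilon> k powr \<alpha> \<le> eps_at h r \<epsilon> (Suc k)"
      using assms(3) h(1) by (simp add: field_simps)
  qed
  show ?thesis
  proof (intro exI[of _ \<epsilon>s] conjI allI impI, goal_cases)
    case 1
    show ?case by fact
  next
    case 2
    show ?case by fact
  next
    case (3 \<epsilon> f fs k)
    then have \<epsilon>: "0 < \<epsilon>" "\<epsilon> < \<epsilon>s" and k: "1 \<le> k" "k \<le> n"
      and f: "f analytic_on stadium L" "sup_norm (stadium L) f \<le> ennreal 1"
      and fs: "\<And>j. j \<le> n - 1 \<Longrightarrow> fs j analytic_on disk h j 1"
        "\<And>j. j \<le> n - 1 \<Longrightarrow> sup_norm (disk h j 1) (fs j) \<le> ennreal 1"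
      and first: "sup_norm (disk h 0 r) (\<lambda>z. fs 0 z - f z) \<le> ennreal (eps_at h r \<epsilon> 0)"
      and link: "\<And>j. 1 \<le> j \<Longrightarrow> j \<le> n - 1 \<Longrightarrow>
          sup_norm (disk h j r) (\<lambda>z. fs j z - fs (j - 1) z) \<le> ennreal (eps_at h r \<epsilon> j)"
      by auto
    have eps_pos: "0 < eps_at h r \<epsilon> j" for j
      using \<epsilon> by (simp add: eps_at_def)
    note iff = sup_norm_le_iff[OF less_imp_le[OF eps_pos]]
    \<comment> \<open>Three circles with \<open>M = 2\<close> and
      \<open>\<delta> = eps_at h r \<epsilon> j\<close>: the disk of radius \<open>r + h\<close>
      about node \<open>j\<close> contains the small disk about node \<open>j + 1\<close>.\<close>
    have step: "norm (fs j z - f z) \<le> eps_at h r \<epsilon> (Suc j)"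
      if j: "j < n" and inner: "\<And>w. w \<in> disk h j r \<Longrightarrow> norm (fs j w - f w) \<le> 2 * eps_at h r \<epsilon> j"
        and z: "z \<in> disk h (Suc j) r" for j z
    proof -
      have "node h j \<le> real n * h"
        using j h(1) unfolding node_def by (intro mult_right_mono) auto
      then have sub: "disk h j 1 \<subseteq> stadium L"
        using h by (intro disk_subset_stadium) (auto simp: node_def)
      have hol: "(\<lambda>w. fs j w - f w) holomorphic_on disk h j 1"
        using fs(1)[of j] f(1) sub j
        by (intro holomorphic_on_diff analytic_imp_holomorphic) (auto intro: analytic_on_subset)
      have bound: "norm (fs j w - f w) \<le> 2" if "w \<in> disk h j 1" for w
      proof -
        have "norm (fs j w) \<le> 1" "norm (f w) \<le> 1"
          using fs(2)[of j] f(2) sub j that unfolding sup_norm_le_iff[OF zero_le_one] by auto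
        then show ?thesis
          using norm_triangle_ineq4[of "fs j w" "f w"] by linarith
      qed
      have "dist (complex_of_real (node h j)) (node h (Suc j)) = h"
        using h by (simp add: node_def dist_norm algebra_simps flip: of_real_mult of_real_add of_real_diff)
      then have "z \<in> ball (complex_of_real (node h j)) (r + h)"
        using z dist_triangle[of "complex_of_real (node h j)" z "node h (Suc j)"] by (simp add: disk_def)
      then have "norm (fs j z - f z) \<le> 2 / (r + h) * eps_at h r \<epsilon> j powr \<alpha>"
        unfolding \<alpha>_def
        using hol bound inner assms h eps_pos eps_less_1[OF \<epsilon>, of j] j
        by (intro three_circles_lossy[where c = "complex_of_real (node h j)"]) (auto simp: disk_def)
      also have "\<dots> \<le> eps_at h r \<epsilon> (Suc j)"
        using \<epsilon> j by (intro absorb) auto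
      finally show ?thesis .
    qed
    \<comment> \<open>Induction with \<open>j = k - 1\<close>. The factor 2 allowed by
      \<open>step\<close> absorbs the triangle inequality, which adds the link error to the error
      already carried to node \<open>j + 1\<close>.\<close>
    have "\<forall>z\<in>disk h (Suc j) r. norm (fs j z - f z) \<le> eps_at h r \<epsilon> (Suc j)" if "j < n" for j
      using that
    proof (induction j)
      case 0
      have "norm (fs 0 w - f w) \<le> 2 * eps_at h r \<epsilon> 0" if "w \<in> disk h 0 r" for w
        using first that eps_pos[of 0] unfolding iff by fastforce
      then show ?case
        using step[of 0] 0 by blast
    next
      case (Suc j)
      have "norm (fs (Suc j) w - f w) \<le> 2 * eps_at h r \<epsilon> (Suc j)" if "w \<in> disk h (Suc j) r" for w
      proof -
        have "norm (fs (Suc j) w - fs j w) \<le> eps_at h r \<epsilon> (Suc j)"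
          using link[of "Suc j"] Suc.prems that unfolding iff by simp
        moreover have "norm (fs j w - f w) \<le> eps_at h r \<epsilon> (Suc j)"
          using Suc that by simp
        ultimately show ?thesis
          using norm_triangle_ineq[of "fs (Suc j) w - fs j w" "fs j w - f w"] by simp
      qed
      then show ?case
        using step[of "Suc j"] Suc.prems by blast
    qed
    from this[of "k - 1"] show ?case
      using k unfolding iff by simp
  qed
qed

end
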